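(* Let $\mathcal{K}$ be an essentially small tensor triangulated category. Then the following conditions are equivalent: (a) $\operatorname{Spc}(\mathcal{K})$ is weakly Noetherian and every radical ideal in $\mathcal{K}$ is finitely generated; (b) $\operatorname{Spc}(\mathcal{K})$ is weakly Noetherian and every prime ideal in $\mathcal{K}$ is finitely generated; (c) $\operatorname{Spc}(\mathcal{K})$ is finite.
   Context: A tensor triangulated category (tt-category) is a triangulated category $\mathcal{K}$ with a symmetric monoidal structure $(\otimes,\mathbb{1})$ whose tensor product is exact in each variable. An ideal in $\mathcal{K}$ means a thick tensor ideal: a full triangulated subcategory closed under direct summands and under tensoring with arbitrary objects of $\mathcal{K}$. For a collection of objects $X_1,\dots,X_n$, $\langle X_1,\dots,X_n\rangle_\otimes$ denotes the smallest ideal containing them. The radical of an ideal $\mathcal{I}$ is $\sqrt{\mathcal{I}}=\{x\in\mathcal{K} : x^{\otimes n}\in\mathcal{I}\text{ for some } n\geq 1\}$, and $\mathcal{I}$ is radical if $\sqrt{\mathcal{I}}=\mathcal{I}$. A radical ideal $\mathcal{I}$ is finitely generated if there are finitely many objects $X_1,\dots,X_n\in\mathcal{K}$ with $\mathcal{I}=\sqrt{\langle X_1,\dots,X_n\rangle_\otimes}$. A prime ideal is a proper ideal $\mathcal{P}$ such that $x\otimes y\in\mathcal{P}$ implies $x\in\mathcal{P}$ or $y\in\mathcal{P}$; prime ideals are radical. The (Balmer) spectrum $\operatorname{Spc}(\mathcal{K})$ is the set of prime ideals of $\mathcal{K}$ with the topology having the sets $\operatorname{supp}(x)=\{\mathcal{P}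 : x\notin\mathcal{P}\}$, $x\in\mathcal{K}$, as a basis of closed subsets; it is a spectral space. Let $X$ be a spectral space. A subset of $X$ is Thomason if it is a union of complements of quasi-compact open subsets of $X$. A subset $V\subseteq X$ is weakly visible if there are Thomason subsets $W_1,W_2\subseteq X$ with $V=W_1\cap(X\setminus W_2)$; a point $x$ is weakly visible if $\{x\}$ is. $X$ is weakly Noetherian if every point of $X$ is weakly visible. *)

theory Defs
  imports "HOL-Algebra.Group" "HOL-Analysis.Abstract_Topology"
begin

text \<open>
  A category is given by a set of objects and a set of arrows inside arbitrary types, so every
  category below is small. \<open>g \<cdot> f\<close> is the composite of \<open>f\<close> followed by \<open>g\<close>; its value is
  irrelevant when \<open>f\<close> and \<open>g\<close> are not composable arrows.
\<close>

record ('o, 'm) cat =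
  obj :: "'o set"
  arr :: "'m set"
  src :: "'m \<Rightarrow> 'o"
  tgt :: "'m \<Rightarrow> 'o"
  idn :: "'o \<Rightarrow> 'm"
  cmp :: "'m \<Rightarrow> 'm \<Rightarrow> 'm"  (infixl "\<cdot>\<index>" 70)

definition hom_set :: "('o, 'm, 'z) cat_scheme \<Rightarrow> 'o \<Rightarrow> 'o \<Rightarrow> 'm set" where
  "hom_set C X Y = {f \<in> arr C. src C f = X \<and> tgt C f = Y}"

locale category =
  fixes C :: "('o, 'm, 'z) cat_scheme" (structure)
  assumes src_obj: "f \<in> arr C \<Longrightarrow> src C f \<in> obj C"
    and tgt_obj: "f \<in> arr C \<Longrightarrow> tgt C f \<in> obj C"
    and idn_hom: "X \<in> obj C \<Longrightarrow> idn C X \<in> hom_set C X X"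
    and cmp_hom: "f \<in> hom_set C X Y \<Longrightarrow> g \<in> hom_set C Y Z \<Longrightarrow> g \<cdot> f \<in> hom_set C X Z"
    and cmp_idn_left: "f \<in> hom_set C X Y \<Longrightarrow> idn C Y \<cdot> f = f"
    and cmp_idn_right: "f \<in> hom_set C X Y \<Longrightarrow> f \<cdot> idn C X = f"
    and cmp_assoc: "f \<in> hom_set C W X \<Longrightarrow> g \<in> hom_set C X Y \<Longrightarrow> h \<in> hom_set C Y Z
          \<Longrightarrow> (h \<cdot> g) \<cdot> f = h \<cdot> (g \<cdot> f)"

definition iso_hom :: "('o, 'm, 'z) cat_scheme \<Rightarrow> 'o \<Rightarrow> 'o \<Rightarrow> 'm set" where
  "iso_hom C X Y = {f \<in> hom_set C X Y.
     \<exists>g \<in> hom_set C Y X. cmp C g f = idn C X \<and> cmp C f g = idn C Y}"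

locale endofunctor = category C
  for C :: "('o, 'm, 'z) cat_scheme" (structure)
    and Fo :: "'o \<Rightarrow> 'o" and Fm :: "'m \<Rightarrow> 'm" +
  assumes map_obj: "X \<in> obj C \<Longrightarrow> Fo X \<in> obj C"
    and map_hom: "f \<in> hom_set C X Y \<Longrightarrow> Fm f \<in> hom_set C (Fo X) (Fo Y)"
    and map_idn: "X \<in> obj C \<Longrightarrow> Fm (idn C X) = idn C (Fo X)"
    and map_cmp: "f \<in> hom_set C X Y \<Longrightarrow> g \<in> hom_set C Y Z \<Longrightarrow> Fm (g \<cdot> f) = Fm g \<cdot> Fm f"

locale autoequivalence = endofunctor C Fo Fm
  for C :: "('o, 'm, 'z) cat_scheme" (structure)
    and Fo :: "'o \<Rightarrow> 'o" and Fm :: "'m \<Rightarrow> 'm" +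
  assumes fully_faithful:
      "X \<in> obj C \<Longrightarrow> Y \<in> obj C \<Longrightarrow> bij_betw Fm (hom_set C X Y) (hom_set C (Fo X) (Fo Y))"
    and essentially_surjective:
      "Y \<in> obj C \<Longrightarrow> \<exists>X \<in> obj C. iso_hom C (Fo X) Y \<noteq> {}"

record ('o, 'm) add_cat = "('o, 'm) cat" +
  plus :: "'m \<Rightarrow> 'm \<Rightarrow> 'm"
  zero :: "'o \<Rightarrow> 'o \<Rightarrow> 'm"

definition hom_group :: "('o, 'm, 'z) add_cat_scheme \<Rightarrow> 'o \<Rightarrow> 'o \<Rightarrow> 'm monoid" where
  "hom_group C X Y = \<lparr>carrier = hom_set C X Y, monoid.mult = plus C, one = zero C X Y\<rparr>"

definition neg :: "('o, 'm, 'z) add_cat_scheme \<Rightarrow> 'm \<Rightarrow> 'm" where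
  "neg C f = inv\<^bsub>hom_group C (src C f) (tgt C f)\<^esub> f"

definition zero_object :: "('o, 'm, 'z) cat_scheme \<Rightarrow> 'o \<Rightarrow> bool" where
  "zero_object C Z \<longleftrightarrow> Z \<in> obj C \<and>
     (\<forall>X \<in> obj C. (\<exists>!f. f \<in> hom_set C X Z) \<and> (\<exists>!f. f \<in> hom_set C Z X))"

definition biproduct ::
  "('o, 'm, 'z) add_cat_scheme \<Rightarrow> 'o \<Rightarrow> 'o \<Rightarrow> 'o \<Rightarrow> 'm \<Rightarrow> 'm \<Rightarrow> 'm \<Rightarrow> 'm \<Rightarrow> bool" where
  "biproduct C X Y B i j p q \<longleftrightarrow>
     X \<in> obj C \<and> Y \<in> obj C \<and> B \<in> obj C \<and>
     i \<in> hom_set C X B \<and> j \<in> hom_set C Y B \<and> p \<in> hom_set C B X \<and> q \<in> hom_set C B Y \<and>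
     cmp C p i = idn C X \<and> cmp C q j = idn C Y \<and>
     cmp C q i = zero C X Y \<and> cmp C p j = zero C Y X \<and>
     plus C (cmp C i p) (cmp C j q) = idn C B"

definition is_direct_sum :: "('o, 'm, 'z) add_cat_scheme \<Rightarrow> 'o \<Rightarrow> 'o \<Rightarrow> 'o \<Rightarrow> bool" where
  "is_direct_sum C X Y B \<longleftrightarrow> (\<exists>i j p q. biproduct C X Y B i j p q)"

locale additive_category = category C
  for C :: "('o, 'm, 'z) add_cat_scheme" (structure) +
  assumes hom_comm_group: "X \<in> obj C \<Longrightarrow> Y \<in> obj C \<Longrightarrow> comm_group (hom_group C X Y)"
    and cmp_plus_right: "f \<in> hom_set C X Y \<Longrightarrow> f' \<in> hom_set C X Y \<Longrightarrow> g \<in> hom_set C Y Z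
          \<Longrightarrow> g \<cdot> plus C f f' = plus C (g \<cdot> f) (g \<cdot> f')"
    and cmp_plus_left: "f \<in> hom_set C X Y \<Longrightarrow> g \<in> hom_set C Y Z \<Longrightarrow> g' \<in> hom_set C Y Z
          \<Longrightarrow> plus C g g' \<cdot> f = plus C (g \<cdot> f) (g' \<cdot> f)"
    and ex_zero_object: "\<exists>Z. zero_object C Z"
    and ex_direct_sum: "X \<in> obj C \<Longrightarrow> Y \<in> obj C \<Longrightarrow> \<exists>B. is_direct_sum C X Y B"

locale additive_endofunctor = additive_category C + endofunctor C Fo Fm
  for C :: "('o, 'm, 'z) add_cat_scheme" (structure)
    and Fo :: "'o \<Rightarrow> 'o" and Fm :: "'m \<Rightarrow> 'm" +
  assumes map_plus: "f \<in> hom_set C X Y \<Longrightarrow> g \<in> hom_set C X Y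
          \<Longrightarrow> Fm (plus C f g) = plus C (Fm f) (Fm g)"

text \<open>
  A triple \<open>(f, g, h)\<close> of arrows stands for the triangle \<open>X \<rightarrow> Y \<rightarrow> Z \<rightarrow> \<Sigma>X\<close>; the objects are
  recovered as sources and targets.
\<close>

record ('o, 'm) tri_cat = "('o, 'm) add_cat" +
  sho :: "'o \<Rightarrow> 'o"
  shm :: "'m \<Rightarrow> 'm"
  dist_tri :: "('m \<times> 'm \<times> 'm) set"

definition triangle ::
  "('o, 'm, 'z) tri_cat_scheme \<Rightarrow> 'o \<Rightarrow> 'o \<Rightarrow> 'o \<Rightarrow> 'm \<Rightarrow> 'm \<Rightarrow> 'm \<Rightarrow> bool" where
  "triangle C X Y Z f g h \<longleftrightarrow> X \<in> obj C \<and> Y \<in> obj C \<and> Z \<in> obj C \<and>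
     f \<in> hom_set C X Y \<and> g \<in> hom_set C Y Z \<and> h \<in> hom_set C Z (sho C X)"

definition distinguished ::
  "('o, 'm, 'z) tri_cat_scheme \<Rightarrow> 'o \<Rightarrow> 'o \<Rightarrow> 'o \<Rightarrow> 'm \<Rightarrow> 'm \<Rightarrow> 'm \<Rightarrow> bool" where
  "distinguished C X Y Z f g h \<longleftrightarrow> triangle C X Y Z f g h \<and> (f, g, h) \<in> dist_tri C"

locale triangulated_category = additive_category C +
    additive_endofunctor C "sho C" "shm C" + autoequivalence C "sho C" "shm C"
  for C :: "('o, 'm, 'z) tri_cat_scheme" (structure) +
  assumes dist_iso:
      "distinguished C X Y Z f g h \<Longrightarrow> triangle C X' Y' Z' f' g' h'
       \<Longrightarrow> a \<in> iso_hom C X X' \<Longrightarrow> b \<in> iso_hom C Y Y' \<Longrightarrow> c \<in> iso_hom C Z Z'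
       \<Longrightarrow> f' \<cdot> a = b \<cdot> f \<Longrightarrow> g' \<cdot> b = c \<cdot> g \<Longrightarrow> h' \<cdot> c = shm C a \<cdot> h
       \<Longrightarrow> distinguished C X' Y' Z' f' g' h'"
    and dist_idn:
      "X \<in> obj C \<Longrightarrow> zero_object C Z
       \<Longrightarrow> distinguished C X X Z (idn C X) (zero C X Z) (zero C Z (sho C X))"
    and dist_cone:
      "X \<in> obj C \<Longrightarrow> Y \<in> obj C \<Longrightarrow> f \<in> hom_set C X Y \<Longrightarrow> \<exists>Z g h. distinguished C X Y Z f g h"
    and dist_rotate:
      "triangle C X Y Z f g h
       \<Longrightarrow> distinguished C X Y Z f g h \<longleftrightarrow> distinguished C Y Z (sho C X) g h (neg C (shm C f))"
    and dist_fill_in: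
      "distinguished C X Y Z f g h \<Longrightarrow> distinguished C X' Y' Z' f' g' h'
       \<Longrightarrow> a \<in> hom_set C X X' \<Longrightarrow> b \<in> hom_set C Y Y' \<Longrightarrow> f' \<cdot> a = b \<cdot> f
       \<Longrightarrow> \<exists>c \<in> hom_set C Z Z'. g' \<cdot> b = c \<cdot> g \<and> h' \<cdot> c = shm C a \<cdot> h"
    and octahedral:
      "distinguished C X Y A f p d \<Longrightarrow> distinguished C X Z B (g \<cdot> f) p' d'
       \<Longrightarrow> distinguished C Y Z D g p'' d''
       \<Longrightarrow> \<exists>u v. distinguished C A B D u v (shm C p \<cdot> d'')
             \<and> u \<cdot> p = p' \<cdot> g \<and> d' \<cdot> u = d \<and> v \<cdot> p' = p'' \<and> d'' \<cdot> v = shm C f \<cdot> d'"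

text \<open>
  The comparison \<open>F\<Sigma> \<cong> \<Sigma>F\<close> is only required to exist. When this is applied to the functors
  \<open>X \<odot> -\<close> and \<open>- \<odot> X\<close> below, no compatibility between the comparisons for different \<open>X\<close> is assumed.
\<close>

definition exact_endofunctor ::
  "('o, 'm, 'z) tri_cat_scheme \<Rightarrow> ('o \<Rightarrow> 'o) \<Rightarrow> ('m \<Rightarrow> 'm) \<Rightarrow> bool" where
  "exact_endofunctor C Fo Fm \<longleftrightarrow> additive_endofunctor C Fo Fm \<and>
     (\<exists>\<theta>. (\<forall>X \<in> obj C. \<theta> X \<in> iso_hom C (Fo (sho C X)) (sho C (Fo X))) \<and>
          (\<forall>X \<in> obj C. \<forall>Y \<in> obj C. \<forall>f \<in> hom_set C X Y.
             cmp C (\<theta> Y) (Fm (shm C f)) = cmp C (shm C (Fm f)) (\<theta> X)) \<and>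
          (\<forall>X Y Z f g h. distinguished C X Y Z f g h \<longrightarrow>
             distinguished C (Fo X) (Fo Y) (Fo Z) (Fm f) (Fm g) (cmp C (\<theta> X) (Fm h))))"

record ('o, 'm) tt_cat = "('o, 'm) tri_cat" +
  teno :: "'o \<Rightarrow> 'o \<Rightarrow> 'o"  (infixl "\<odot>\<index>" 75)
  tenm :: "'m \<Rightarrow> 'm \<Rightarrow> 'm"  (infixl "\<star>\<index>" 75)
  tunit :: "'o"
  asc :: "'o \<Rightarrow> 'o \<Rightarrow> 'o \<Rightarrow> 'm"
  lun :: "'o \<Rightarrow> 'm"
  run :: "'o \<Rightarrow> 'm"
  brd :: "'o \<Rightarrow> 'o \<Rightarrow> 'm"

text \<open>
  The structure isomorphisms are \<open>asc X Y Z : (X \<odot> Y) \<odot> Z \<rightarrow> X \<odot> (Y \<odot> Z)\<close>,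
  \<open>lun X : 1 \<odot> X \<rightarrow> X\<close>, \<open>run X : X \<odot> 1 \<rightarrow> X\<close> and \<open>brd X Y : X \<odot> Y \<rightarrow> Y \<odot> X\<close>.
\<close>

locale symmetric_monoidal_category = category C
  for C :: "('o, 'm, 'z) tt_cat_scheme" (structure) +
  assumes ten_obj: "X \<in> obj C \<Longrightarrow> Y \<in> obj C \<Longrightarrow> X \<odot> Y \<in> obj C"
    and ten_hom: "f \<in> hom_set C X X' \<Longrightarrow> g \<in> hom_set C Y Y'
          \<Longrightarrow> f \<star> g \<in> hom_set C (X \<odot> Y) (X' \<odot> Y')"
    and ten_idn: "X \<in> obj C \<Longrightarrow> Y \<in> obj C \<Longrightarrow> idn C X \<star> idn C Y = idn C (X \<odot> Y)"
    and ten_cmp: "f \<in> hom_set C X X' \<Longrightarrow> f' \<in> hom_set C X' X''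
          \<Longrightarrow> g \<in> hom_set C Y Y' \<Longrightarrow> g' \<in> hom_set C Y' Y''
          \<Longrightarrow> (f' \<cdot> f) \<star> (g' \<cdot> g) = (f' \<star> g') \<cdot> (f \<star> g)"
    and unit_obj: "tunit C \<in> obj C"
    and asc_iso: "X \<in> obj C \<Longrightarrow> Y \<in> obj C \<Longrightarrow> Z \<in> obj C
          \<Longrightarrow> asc C X Y Z \<in> iso_hom C ((X \<odot> Y) \<odot> Z) (X \<odot> (Y \<odot> Z))"
    and lun_iso: "X \<in> obj C \<Longrightarrow> lun C X \<in> iso_hom C (tunit C \<odot> X) X"
    and run_iso: "X \<in> obj C \<Longrightarrow> run C X \<in> iso_hom C (X \<odot> tunit C) X"
    and brd_iso: "X \<in> obj C \<Longrightarrow> Y \<in> obj C \<Longrightarrow> brd C X Y \<in> iso_hom C (X \<odot> Y) (Y \<odot> X)"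
    and asc_natural: "f \<in> hom_set C X X' \<Longrightarrow> g \<in> hom_set C Y Y' \<Longrightarrow> h \<in> hom_set C Z Z'
          \<Longrightarrow> asc C X' Y' Z' \<cdot> ((f \<star> g) \<star> h) = (f \<star> (g \<star> h)) \<cdot> asc C X Y Z"
    and lun_natural: "f \<in> hom_set C X X' \<Longrightarrow> lun C X' \<cdot> (idn C (tunit C) \<star> f) = f \<cdot> lun C X"
    and run_natural: "f \<in> hom_set C X X' \<Longrightarrow> run C X' \<cdot> (f \<star> idn C (tunit C)) = f \<cdot> run C X"
    and brd_natural: "f \<in> hom_set C X X' \<Longrightarrow> g \<in> hom_set C Y Y'
          \<Longrightarrow> brd C X' Y' \<cdot> (f \<star> g) = (g \<star> f) \<cdot> brd C X Y"
    and pentagon: "W \<in> obj C \<Longrightarrow> X \<in> obj C \<Longrightarrow> Y \<in> obj C \<Longrightarrow> Z \<in> obj C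
          \<Longrightarrow> asc C W X (Y \<odot> Z) \<cdot> asc C (W \<odot> X) Y Z
             = (idn C W \<star> asc C X Y Z) \<cdot> asc C W (X \<odot> Y) Z \<cdot> (asc C W X Y \<star> idn C Z)"
    and unit_triangle: "X \<in> obj C \<Longrightarrow> Y \<in> obj C
          \<Longrightarrow> (idn C X \<star> lun C Y) \<cdot> asc C X (tunit C) Y = run C X \<star> idn C Y"
    and hexagon: "X \<in> obj C \<Longrightarrow> Y \<in> obj C \<Longrightarrow> Z \<in> obj C
          \<Longrightarrow> asc C Y Z X \<cdot> brd C X (Y \<odot> Z) \<cdot> asc C X Y Z
             = (idn C Y \<star> brd C X Z) \<cdot> asc C Y X Z \<cdot> (brd C X Y \<star> idn C Z)"
    and brd_symmetric: "X \<in> obj C \<Longrightarrow> Y \<in> obj C \<Longrightarrow> brd C Y X \<cdot> brd C X Y = idn C (X \<odot> Y)"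

locale tt_category = triangulated_category C + symmetric_monoidal_category C
  for C :: "('o, 'm, 'z) tt_cat_scheme" (structure) +
  assumes ten_exact_right: "X \<in> obj C \<Longrightarrow> exact_endofunctor C (\<lambda>Y. X \<odot> Y) (\<lambda>f. idn C X \<star> f)"
    and ten_exact_left: "X \<in> obj C \<Longrightarrow> exact_endofunctor C (\<lambda>Y. Y \<odot> X) (\<lambda>f. f \<star> idn C X)"

text \<open>
  Full subcategories are represented by their sets of objects.
  Closure under direct summands makes a thick subcategory closed under isomorphism.
\<close>

definition triangulated_subcategory :: "('o, 'm, 'z) tri_cat_scheme \<Rightarrow> 'o set \<Rightarrow> bool" where
  "triangulated_subcategory C I \<longleftrightarrow> I \<subseteq> obj C \<and>
     (\<forall>Z. zero_object C Z \<longrightarrow> Z \<in> I) \<and>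
     (\<forall>X Y B. is_direct_sum C X Y B \<longrightarrow> X \<in> I \<longrightarrow> Y \<in> I \<longrightarrow> B \<in> I) \<and>
     (\<forall>X \<in> obj C. X \<in> I \<longleftrightarrow> sho C X \<in> I) \<and>
     (\<forall>X Y Z f g h. distinguished C X Y Z f g h \<longrightarrow>
        (X \<in> I \<longrightarrow> Y \<in> I \<longrightarrow> Z \<in> I) \<and> (Y \<in> I \<longrightarrow> Z \<in> I \<longrightarrow> X \<in> I) \<and> (X \<in> I \<longrightarrow> Z \<in> I \<longrightarrow> Y \<in> I))"

definition thick_subcategory :: "('o, 'm, 'z) tri_cat_scheme \<Rightarrow> 'o set \<Rightarrow> bool" where
  "thick_subcategory C I \<longleftrightarrow> triangulated_subcategory C I \<and>
     (\<forall>X Y B. is_direct_sum C X Y B \<longrightarrow> B \<in> I \<longrightarrow> X \<in> I)"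

definition tt_ideal :: "('o, 'm, 'z) tt_cat_scheme \<Rightarrow> 'o set \<Rightarrow> bool" where
  "tt_ideal C I \<longleftrightarrow> thick_subcategory C I \<and>
     (\<forall>X \<in> I. \<forall>Y \<in> obj C. teno C X Y \<in> I \<and> teno C Y X \<in> I)"

definition generated_ideal :: "('o, 'm, 'z) tt_cat_scheme \<Rightarrow> 'o set \<Rightarrow> 'o set" where
  "generated_ideal C S = tt_ideal C hull S"

fun tensor_power :: "('o, 'm, 'z) tt_cat_scheme \<Rightarrow> 'o \<Rightarrow> nat \<Rightarrow> 'o" where
  "tensor_power C X 0 = tunit C"
| "tensor_power C X (Suc 0) = X"
| "tensor_power C X (Suc (Suc n)) = teno C (tensor_power C X (Suc n)) X"

definition radical :: "('o, 'm, 'z) tt_cat_scheme \<Rightarrow> 'o set \<Rightarrow> 'o set" where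
  "radical C I = {X \<in> obj C. \<exists>n\<ge>1. tensor_power C X n \<in> I}"

definition radical_ideal :: "('o, 'm, 'z) tt_cat_scheme \<Rightarrow> 'o set \<Rightarrow> bool" where
  "radical_ideal C I \<longleftrightarrow> tt_ideal C I \<and> radical C I = I"

text \<open>Finite generation is meant up to radical.\<close>

definition finitely_generated :: "('o, 'm, 'z) tt_cat_scheme \<Rightarrow> 'o set \<Rightarrow> bool" where
  "finitely_generated C I \<longleftrightarrow>
     (\<exists>F. finite F \<and> F \<subseteq> obj C \<and> I = radical C (generated_ideal C F))"

definition prime_ideal :: "('o, 'm, 'z) tt_cat_scheme \<Rightarrow> 'o set \<Rightarrow> bool" where
  "prime_ideal C P \<longleftrightarrow> tt_ideal C P \<and> P \<noteq> obj C \<and>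
     (\<forall>X \<in> obj C. \<forall>Y \<in> obj C. teno C X Y \<in> P \<longrightarrow> X \<in> P \<or> Y \<in> P)"

definition Spc :: "('o, 'm, 'z) tt_cat_scheme \<Rightarrow> 'o set set" where
  "Spc C = {P. prime_ideal C P}"

definition supp :: "('o, 'm, 'z) tt_cat_scheme \<Rightarrow> 'o \<Rightarrow> 'o set set" where
  "supp C X = {P \<in> Spc C. X \<notin> P}"

definition spectrum :: "('o, 'm, 'z) tt_cat_scheme \<Rightarrow> 'o set topology" where
  "spectrum C = topology (arbitrary union_of (\<lambda>U. \<exists>X \<in> obj C. U = Spc C - supp C X))"

lemma is_direct_sum_commute:
  assumes "additive_category C" and "is_direct_sum C X Y B"
  shows "is_direct_sum C Y X B"
proof -
  interpret additive_category C by fact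
  obtain i j p q where b: "biproduct C X Y B i j p q"
    using assms(2) by (auto simp: is_direct_sum_def)
  have B: "B \<in> obj C" using b by (simp add: biproduct_def)
  interpret G: comm_group "hom_group C B B" by (rule hom_comm_group[OF B B])
  have "cmp C i p \<in> hom_set C B B" "cmp C j q \<in> hom_set C B B"
    using b by (auto simp: biproduct_def intro: cmp_hom)
  then have "plus C (cmp C i p) (cmp C j q) = plus C (cmp C j q) (cmp C i p)"
    using G.m_comm by (simp add: hom_group_def)
  then have "biproduct C Y X B j i q p"
    using b by (auto simp: biproduct_def)
  then show ?thesis by (auto simp: is_direct_sum_def)
qed

text \<open>
  The complements of the supports are closed under binary intersections, so that they really
  form a basis and \<^const>\<open>spectrum\<close> has the expected open and closed sets.
\<close>

lemma istopology_spectrum: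
  assumes "tt_category C"
  shows "istopology (arbitrary union_of (\<lambda>U. \<exists>X \<in> obj C. U = Spc C - supp C X))"
proof (rule istopology_base)
  interpret tt_category C by fact
  fix S T
  assume "\<exists>X \<in> obj C. S = Spc C - supp C X" "\<exists>X \<in> obj C. T = Spc C - supp C X"
  then obtain X Y where XY: "X \<in> obj C" "Y \<in> obj C"
    and S: "S = Spc C - supp C X" and T: "T = Spc C - supp C Y" by blast
  obtain B where B: "is_direct_sum C X Y B" using ex_direct_sum XY by blast
  have B': "is_direct_sum C Y X B"
    using is_direct_sum_commute[OF additive_category_axioms B] .
  have "B \<in> obj C" using B by (auto simp: is_direct_sum_def biproduct_def)
  moreover have "B \<in> P \<longleftrightarrow> X \<in> P \<and> Y \<in> P" if "P \<in> Spc C" for P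
  proof -
    have "thick_subcategory C P" "triangulated_subcategory C P"
      using that by (auto simp: Spc_def prime_ideal_def tt_ideal_def thick_subcategory_def)
    then have summand: "\<And>X Y. is_direct_sum C X Y B \<Longrightarrow> B \<in> P \<Longrightarrow> X \<in> P"
      and dsum: "\<And>X Y. is_direct_sum C X Y B \<Longrightarrow> X \<in> P \<Longrightarrow> Y \<in> P \<Longrightarrow> B \<in> P"
      unfolding thick_subcategory_def triangulated_subcategory_def by metis+
    show ?thesis using summand[OF B] summand[OF B'] dsum[OF B] by blast
  qed
  then have "S \<inter> T = Spc C - supp C B"
    by (auto simp: S T supp_def)
  ultimately show "\<exists>X \<in> obj C. S \<inter> T = Spc C - supp C X" by blast
qed

lemma openin_spectrum:
  assumes "tt_category C"
  shows "openin (spectrum C) U \<longleftrightarrow> (\<exists>A \<subseteq> obj C. U = (\<Union>X\<in>A. Spc C - supp C X))"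
proof -
  have "openin (spectrum C) U \<longleftrightarrow>
      (arbitrary union_of (\<lambda>U. \<exists>X \<in> obj C. U = Spc C - supp C X)) U"
    by (simp add: spectrum_def topology_inverse' istopology_spectrum[OF assms])
  also have "\<dots> \<longleftrightarrow> (\<exists>\<U> \<subseteq> (\<lambda>X. Spc C - supp C X) ` obj C. \<Union>\<U> = U)"
    unfolding union_of_def arbitrary_def by (rule ex_cong1) auto
  also have "\<dots> \<longleftrightarrow> (\<exists>A \<subseteq> obj C. U = (\<Union>X\<in>A. Spc C - supp C X))"
    by (auto simp: subset_image_iff)
  finally show ?thesis .
qed

lemma topspace_spectrum:
  assumes "tt_category C"
  shows "topspace (spectrum C) = Spc C"
proof
  show "topspace (spectrum C) \<subseteq> Spc C"
    using openin_topspace[of "spectrum C"] unfolding openin_spectrum[OF assms] by blast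
next
  interpret tt_category C by fact
  obtain Z where Z: "zero_object C Z" using ex_zero_object by blast
  then have "Z \<in> obj C" by (simp add: zero_object_def)
  moreover have "Spc C = Spc C - supp C Z"
    using Z by (auto simp: Spc_def supp_def prime_ideal_def tt_ideal_def thick_subcategory_def
        triangulated_subcategory_def)
  ultimately have "openin (spectrum C) (Spc C)"
    unfolding openin_spectrum[OF assms] by (intro exI[of _ "{Z}"]) auto
  then show "Spc C \<subseteq> topspace (spectrum C)" by (rule openin_subset)
qed

definition thomason :: "'a topology \<Rightarrow> 'a set \<Rightarrow> bool" where
  "thomason X W \<longleftrightarrow>
     (\<exists>\<U>. (\<forall>U\<in>\<U>. openin X U \<and> compactin X U) \<and> W = (\<Union>U\<in>\<U>. topspace X - U))"

definition weakly_visible :: "'a topology \<Rightarrow> 'a set \<Rightarrow> bool" where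
  "weakly_visible X V \<longleftrightarrow>
     (\<exists>W1 W2. thomason X W1 \<and> thomason X W2 \<and> V = W1 \<inter> (topspace X - W2))"

definition weakly_noetherian :: "'a topology \<Rightarrow> bool" where
  "weakly_noetherian X \<longleftrightarrow> (\<forall>x \<in> topspace X. weakly_visible X {x})"

end

theory Submission
  imports Defs "HOL-Analysis.Function_Topology"
begin

text \<open>
  A radical ideal is the intersection of the primes containing it. If the spectrum is finite, it
  is therefore generated, up to radical, by finitely many objects separating it from the primes
  that do not contain it.

  Conversely, suppose that the spectrum is infinite. Being a prime ideal is a condition on finitely
  many memberships at a time, so the primes form a compact subset of the power set of the objects
  and have an accumulation point \<open>P\<close>, which is itself prime. If \<open>P\<close> is finitely generated, then
  finitely many members of \<open>P\<close> force \<open>P \<subseteq> Q\<close>; if \<open>P\<close> is moreover weakly visible, then excluding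
  finitely many further objects forces \<open>Q = P\<close>. So \<open>P\<close> would be isolated.
\<close>

section \<open>Accumulation points of families of sets\<close>

text \<open>The set \<open>P\<close> is an accumulation point of \<open>\<Q>\<close> in the Cantor cube, which is compact by Tychonoff.\<close>

lemma infinite_family_accumulation:
  fixes \<Q> :: "'a set set"
  assumes "infinite \<Q>"
  shows "\<exists>P. \<forall>A B. finite A \<longrightarrow> finite B \<longrightarrow> A \<subseteq> P \<longrightarrow> B \<inter> P = {} \<longrightarrow>
           (\<exists>Q\<in>\<Q>. Q \<noteq> P \<and> A \<subseteq> Q \<and> B \<inter> Q = {})"
proof -
  let ?X = "product_topology (\<lambda>_::'a. discrete_topology (UNIV::bool set)) UNIV"
  let ?T = "(\<lambda>Q x. x \<in> Q) ` \<Q>"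
  have "compact_space ?X"
    by (simp add: compact_space_product_topology compact_space_discrete_topology)
  moreover have "infinite ?T"
    using assms by (subst finite_image_iff) (auto simp: inj_on_def fun_eq_iff)
  ultimately have "topspace ?X \<inter> ?X derived_set_of ?T \<noteq> {}"
    by (intro compactin_imp_Bolzano_Weierstrass) (auto simp: compact_space_def)
  then obtain p where p: "p \<in> ?X derived_set_of ?T" by blast
  have "\<exists>Q\<in>\<Q>. Q \<noteq> Collect p \<and> A \<subseteq> Q \<and> B \<inter> Q = {}"
    if "finite A" "finite B" "A \<subseteq> Collect p" "B \<inter> Collect p = {}" for A B
  proof -
    \<comment> \<open>The basic box of the Cantor cube that prescribes membership for
      \<open>A\<close> and non-membership for \<open>B\<close>; the two prescriptions do not
      conflict, because \<open>A\<close> lies inside \<open>Collect p\<close> and \<open>B\<close>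
      outside it. Only coordinates in the finite set \<open>A \<union> B\<close> are restricted, so
      the box is open.\<close>
    let ?U = "PiE UNIV (\<lambda>x. if x \<in> A then {True} else if x \<in> B then {False} else UNIV)"
    have "openin ?X ?U"
      unfolding openin_PiE_gen
      using that by (auto intro!: disjI2 intro: finite_subset[of _ "A \<union> B"])
    moreover have "p \<in> ?U" using that by (auto simp: PiE_def)
    ultimately obtain Q where Q: "Q \<in> \<Q>" "(\<lambda>x. x \<in> Q) \<noteq> p" "(\<lambda>x. x \<in> Q) \<in> ?U"
      using p unfolding in_derived_set_of by blast
    have "A \<subseteq> Q" using Q(3) by (auto simp: PiE_iff split: if_splits)
    moreover have "x \<notin> Q" if "x \<in> B" for x
      using Q(3) \<open>x \<in> B\<close> \<open>B \<inter> Collect p = {}\<close> \<open>A \<subseteq> Collect p\<close>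
      by (auto simp: PiE_iff split: if_splits dest!: spec[of _ x])
    ultimately have "A \<subseteq> Q" "B \<inter> Q = {}" by blast+
    moreover have "Q \<noteq> Collect p" using Q(2) by auto
    ultimately show ?thesis using Q(1) by blast
  qed
  then show ?thesis by blast
qed

section \<open>Zero morphisms and isomorphisms\<close>

context additive_category
begin

lemma zero_hom: "X \<in> obj C \<Longrightarrow> Y \<in> obj C \<Longrightarrow> zero C X Y \<in> hom_set C X Y"
  using comm_group.axioms(2)[OF hom_comm_group, of X Y] group.is_monoid monoid.one_closed
  by (fastforce simp: hom_group_def)

lemma plus_zero: "f \<in> hom_set C X Y \<Longrightarrow> plus C f (zero C X Y) = f"
  using hom_comm_group[of X Y] src_obj tgt_obj
    monoid.r_one[of "hom_group C X Y" f]
  by (auto simp: hom_group_def hom_set_def comm_group_def comm_monoid_def)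

text \<open>An idempotent of a group is neutral. This recognises zero morphisms by an equation that
  composition and additive functors preserve.\<close>

lemma zero_eqI:
  assumes "f \<in> hom_set C X Y" "plus C f f = f"
  shows "f = zero C X Y"
proof -
  have "X \<in> obj C" "Y \<in> obj C" using assms(1) src_obj tgt_obj by (auto simp: hom_set_def)
  then interpret G: comm_group "hom_group C X Y" by (rule hom_comm_group)
  have "f = \<one>\<^bsub>hom_group C X Y\<^esub>"
    using assms by (intro G.l_cancel_one[THEN iffD1, of f f])
      (auto simp: hom_group_def)
  then show ?thesis by (simp add: hom_group_def)
qed

lemma cmp_zero_left:
  assumes "f \<in> hom_set C X Y" "Z \<in> obj C"
  shows "zero C Y Z \<cdot> f = zero C X Z"
proof (rule zero_eqI)
  have Y: "Y \<in> obj C" using assms tgt_obj by (auto simp: hom_set_def)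
  note z = zero_hom[OF Y assms(2)]
  show "zero C Y Z \<cdot> f \<in> hom_set C X Z" using cmp_hom[OF assms(1) z] .
  show "plus C (zero C Y Z \<cdot> f) (zero C Y Z \<cdot> f) = zero C Y Z \<cdot> f"
    using cmp_plus_left[OF assms(1) z z] plus_zero[OF z] by simp
qed

text \<open>This turns closure under direct summands into closure under isomorphism. Equations
  between arrows into or out of \<open>Z\<close> hold because such arrows are unique.\<close>

lemma iso_is_direct_sum:
  assumes "f \<in> iso_hom C X Y" and Z: "zero_object C Z"
  shows "is_direct_sum C Y Z X"
proof -
  obtain g where f: "f \<in> hom_set C X Y" and g: "g \<in> hom_set C Y X"
    and gf: "g \<cdot> f = idn C X" and fg: "f \<cdot> g = idn C Y"
    using assms by (auto simp: iso_hom_def)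
  have X: "X \<in> obj C" and Y: "Y \<in> obj C"
    using f src_obj tgt_obj by (auto simp: hom_set_def)
  have Zo: "Z \<in> obj C" using Z by (simp add: zero_object_def)
  have into: "a = b" if "a \<in> hom_set C W Z" "b \<in> hom_set C W Z" "W \<in> obj C" for a b W
    using Z that by (auto simp: zero_object_def)
  have from_Z: "a = b" if "a \<in> hom_set C Z W" "b \<in> hom_set C Z W" "W \<in> obj C" for a b W
    using Z that by (auto simp: zero_object_def)
  let ?j = "zero C Z X" and ?q = "zero C X Z"
  note jq = zero_hom[OF Zo X] zero_hom[OF X Zo]
  have "biproduct C Y Z X g ?j f ?q"
    unfolding biproduct_def
  proof (intro conjI)
    show "?q \<cdot> ?j = idn C Z" by (rule into[OF cmp_hom[OF jq] idn_hom[OF Zo] Zo])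
    show "?q \<cdot> g = zero C Y Z" by (rule into[OF cmp_hom[OF g jq(2)] zero_hom[OF Y Zo] Y])
    show "f \<cdot> ?j = zero C Z Y" by (rule from_Z[OF cmp_hom[OF jq(1) f] zero_hom[OF Zo Y] Y])
    show "plus C (g \<cdot> f) (?j \<cdot> ?q) = idn C X"
      by (simp add: gf cmp_zero_left[OF jq(2) X] plus_zero[OF idn_hom[OF X]])
  qed (use X Y Zo f g jq fg in auto)
  then show ?thesis by (auto simp: is_direct_sum_def)
qed

end

lemma (in category) iso_hom_sym: "f \<in> iso_hom C X Y \<Longrightarrow> \<exists>g. g \<in> iso_hom C Y X"
  by (auto simp: iso_hom_def)

lemma (in endofunctor) map_iso:
  assumes "f \<in> iso_hom C X Y"
  shows "Fm f \<in> iso_hom C (Fo X) (Fo Y)"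
proof -
  obtain g where fg: "f \<in> hom_set C X Y" "g \<in> hom_set C Y X" "g \<cdot> f = idn C X" "f \<cdot> g = idn C Y"
    using assms by (auto simp: iso_hom_def)
  then have "X \<in> obj C" "Y \<in> obj C" using src_obj tgt_obj by (auto simp: hom_set_def)
  then have "Fm g \<cdot> Fm f = idn C (Fo X)" "Fm f \<cdot> Fm g = idn C (Fo Y)"
    using map_cmp[of f X Y g X] map_cmp[of g Y X f Y] map_idn fg by auto
  then show ?thesis using map_hom fg by (auto simp: iso_hom_def)
qed

lemma (in additive_endofunctor) map_zero:
  assumes "X \<in> obj C" "Y \<in> obj C"
  shows "Fm (zero C X Y) = zero C (Fo X) (Fo Y)"
  using zero_hom[OF assms] plus_zero[OF zero_hom[OF assms]] map_plus map_hom
  by (metis zero_eqI)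

text \<open>Biproducts are characterised by equations between arrows, which an additive functor
  preserves.\<close>

lemma (in additive_endofunctor) map_is_direct_sum:
  assumes "is_direct_sum C X Y B"
  shows "is_direct_sum C (Fo X) (Fo Y) (Fo B)"
proof -
  obtain i j p q where b: "biproduct C X Y B i j p q"
    using assms by (auto simp: is_direct_sum_def)
  then have i: "i \<in> hom_set C X B" and j: "j \<in> hom_set C Y B"
    and p: "p \<in> hom_set C B X" and q: "q \<in> hom_set C B Y"
    and o: "X \<in> obj C" "Y \<in> obj C" "B \<in> obj C"
    by (auto simp: biproduct_def)
  have "plus C (Fm i \<cdot> Fm p) (Fm j \<cdot> Fm q) = Fm (plus C (i \<cdot> p) (j \<cdot> q))"
    using map_plus[OF cmp_hom[OF p i] cmp_hom[OF q j]] map_cmp[OF p i] map_cmp[OF q j] by simp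
  then have "biproduct C (Fo X) (Fo Y) (Fo B) (Fm i) (Fm j) (Fm p) (Fm q)"
    using b o map_cmp[OF i p, symmetric] map_cmp[OF j q, symmetric] map_cmp[OF i q, symmetric]
      map_cmp[OF j p, symmetric]
    by (simp add: biproduct_def map_obj map_hom map_idn map_zero)
  then show ?thesis by (auto simp: is_direct_sum_def)
qed

section \<open>Ideals\<close>

context
  fixes C :: "('o, 'm, 'z) tt_cat_scheme" and I :: "'o set"
  assumes I: "tt_ideal C I"
begin

lemma tt_ideal_subset: "I \<subseteq> obj C"
  using I by (simp add: tt_ideal_def thick_subcategory_def triangulated_subcategory_def)

lemma tt_ideal_zero: "zero_object C Z \<Longrightarrow> Z \<in> I"
  using I by (simp add: tt_ideal_def thick_subcategory_def triangulated_subcategory_def)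

lemma tt_ideal_direct_sum: "is_direct_sum C X Y B \<Longrightarrow> X \<in> I \<Longrightarrow> Y \<in> I \<Longrightarrow> B \<in> I"
  using I unfolding tt_ideal_def thick_subcategory_def triangulated_subcategory_def by blast

lemma tt_ideal_summand: "is_direct_sum C X Y B \<Longrightarrow> B \<in> I \<Longrightarrow> X \<in> I"
  using I unfolding tt_ideal_def thick_subcategory_def by blast

lemma tt_ideal_shift: "X \<in> obj C \<Longrightarrow> sho C X \<in> I \<longleftrightarrow> X \<in> I"
  using I by (simp add: tt_ideal_def thick_subcategory_def triangulated_subcategory_def)

lemma tt_ideal_triangle:
  assumes "distinguished C X Y Z f g h"
  shows "X \<in> I \<Longrightarrow> Y \<in> I \<Longrightarrow> Z \<in> I" "Y \<in> I \<Longrightarrow> Z \<in> I \<Longrightarrow> X \<in> I" "X \<in> I \<Longrightarrow> Z \<in> I \<Longrightarrow> Y \<in> I"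
proof -
  have "(X \<in> I \<longrightarrow> Y \<in> I \<longrightarrow> Z \<in> I) \<and> (Y \<in> I \<longrightarrow> Z \<in> I \<longrightarrow> X \<in> I) \<and> (X \<in> I \<longrightarrow> Z \<in> I \<longrightarrow> Y \<in> I)"
    using I assms unfolding tt_ideal_def thick_subcategory_def triangulated_subcategory_def by blast
  then show "X \<in> I \<Longrightarrow> Y \<in> I \<Longrightarrow> Z \<in> I" "Y \<in> I \<Longrightarrow> Z \<in> I \<Longrightarrow> X \<in> I" "X \<in> I \<Longrightarrow> Z \<in> I \<Longrightarrow> Y \<in> I"
    by auto
qed

lemma tt_ideal_tensor:
  "X \<in> I \<Longrightarrow> Y \<in> obj C \<Longrightarrow> teno C X Y \<in> I" "X \<in> I \<Longrightarrow> Y \<in> obj C \<Longrightarrow> teno C Y X \<in> I"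
  using I by (auto simp: tt_ideal_def)

end

lemma tt_idealI:
  assumes "I \<subseteq> obj C"
    and "\<And>Z. zero_object C Z \<Longrightarrow> Z \<in> I"
    and "\<And>X Y B. is_direct_sum C X Y B \<Longrightarrow> X \<in> I \<Longrightarrow> Y \<in> I \<Longrightarrow> B \<in> I"
    and "\<And>X Y B. is_direct_sum C X Y B \<Longrightarrow> B \<in> I \<Longrightarrow> X \<in> I"
    and "\<And>X. X \<in> obj C \<Longrightarrow> X \<in> I \<Longrightarrow> sho C X \<in> I"
    and "\<And>X. X \<in> obj C \<Longrightarrow> sho C X \<in> I \<Longrightarrow> X \<in> I"
    and "\<And>X Y Z f g h. distinguished C X Y Z f g h \<Longrightarrow> X \<in> I \<Longrightarrow> Y \<in> I \<Longrightarrow> Z \<in> I"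
    and "\<And>X Y Z f g h. distinguished C X Y Z f g h \<Longrightarrow> Y \<in> I \<Longrightarrow> Z \<in> I \<Longrightarrow> X \<in> I"
    and "\<And>X Y Z f g h. distinguished C X Y Z f g h \<Longrightarrow> X \<in> I \<Longrightarrow> Z \<in> I \<Longrightarrow> Y \<in> I"
    and "\<And>X Y. X \<in> I \<Longrightarrow> Y \<in> obj C \<Longrightarrow> teno C X Y \<in> I"
    and "\<And>X Y. X \<in> I \<Longrightarrow> Y \<in> obj C \<Longrightarrow> teno C Y X \<in> I"
  shows "tt_ideal C I"
  unfolding tt_ideal_def thick_subcategory_def triangulated_subcategory_def
  using assms by (intro conjI allI impI ballI iffI) blast+

text \<open>The family has to be nonempty because an empty intersection is the whole type rather
  than \<open>obj C\<close>.\<close>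

lemma tt_ideal_Inter:
  assumes "\<J> \<noteq> {}" "\<And>J. J \<in> \<J> \<Longrightarrow> tt_ideal C J"
  shows "tt_ideal C (\<Inter>\<J>)"
proof (rule tt_idealI)
  show "\<Inter>\<J> \<subseteq> obj C" using assms tt_ideal_subset by blast
next
  fix X assume "X \<in> obj C"
  then have shift: "sho C X \<in> J \<longleftrightarrow> X \<in> J" if "J \<in> \<J>" for J
    using tt_ideal_shift[OF assms(2)[OF that]] by blast
  { assume "X \<in> \<Inter>\<J>" then show "sho C X \<in> \<Inter>\<J>" using shift by blast }
  { assume "sho C X \<in> \<Inter>\<J>" then show "X \<in> \<Inter>\<J>" using shift by blast }
next
  fix X Y Z f g h assume "distinguished C X Y Z f g h"
  note tri = tt_ideal_triangle[OF assms(2) this]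
  { assume "X \<in> \<Inter>\<J>" "Y \<in> \<Inter>\<J>" then show "Z \<in> \<Inter>\<J>" using tri(1) by blast }
  { assume "Y \<in> \<Inter>\<J>" "Z \<in> \<Inter>\<J>" then show "X \<in> \<Inter>\<J>" using tri(2) by blast }
  { assume "X \<in> \<Inter>\<J>" "Z \<in> \<Inter>\<J>" then show "Y \<in> \<Inter>\<J>" using tri(3) by blast }
next
  fix Z assume "zero_object C Z"
  then show "Z \<in> \<Inter>\<J>" using tt_ideal_zero[OF assms(2)] by blast
next
  fix X Y B assume "is_direct_sum C X Y B"
  note sum = tt_ideal_direct_sum[OF assms(2) this] tt_ideal_summand[OF assms(2) this]
  { assume "X \<in> \<Inter>\<J>" "Y \<in> \<Inter>\<J>" then show "B \<in> \<Inter>\<J>" using sum(1) by blast }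
  { assume "B \<in> \<Inter>\<J>" then show "X \<in> \<Inter>\<J>" using sum(2) by blast }
next
  fix X Y assume "X \<in> \<Inter>\<J>" "Y \<in> obj C"
  then show "teno C X Y \<in> \<Inter>\<J>" "teno C Y X \<in> \<Inter>\<J>"
    using tt_ideal_tensor[OF assms(2)] by blast+
qed

text \<open>
  The axioms of an ideal are finitary, so ideals form a closed subset of the power set of the
  objects. This covers both unions of chains and accumulation points of the spectrum.
\<close>

lemma tt_ideal_finitary:
  assumes approx: "\<And>A B. finite A \<Longrightarrow> finite B \<Longrightarrow> A \<subseteq> P \<Longrightarrow> B \<inter> P = {} \<Longrightarrow>
      \<exists>Q. tt_ideal C Q \<and> A \<subseteq> Q \<and> B \<inter> Q = {}"
  shows "tt_ideal C P"
proof -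
  \<comment> \<open>Each closure axiom says that finitely many members force one more. If the forced
    object \<open>Z\<close> were outside \<open>P\<close>, an ideal approximating \<open>P\<close>
    on \<open>A\<close> and \<open>{Z}\<close> would violate the axiom.\<close>
  have closed: "Z \<in> P" if "finite A" "A \<subseteq> P" "\<And>Q. tt_ideal C Q \<Longrightarrow> A \<subseteq> Q \<Longrightarrow> Z \<in> Q" for A Z
    using approx[of A "{Z}"] that by blast
  show ?thesis
  proof (rule tt_idealI)
    show "P \<subseteq> obj C"
    proof
      fix X assume "X \<in> P"
      then show "X \<in> obj C" using approx[of "{X}" "{}"] tt_ideal_subset by auto
    qed
  next
    fix Z assume *: "zero_object C Z"
    show "Z \<in> P" by (rule closed[of "{}"]) (use tt_ideal_zero[OF _ *] in auto)
  next
    fix X Y B assume *: "is_direct_sum C X Y B"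
    { assume "X \<in> P" "Y \<in> P"
      then show "B \<in> P"
        by (intro closed[of "{X, Y}"]) (use tt_ideal_direct_sum[OF _ *] in auto) }
    { assume "B \<in> P"
      then show "X \<in> P" by (intro closed[of "{B}"]) (use tt_ideal_summand[OF _ *] in auto) }
  next
    fix X assume *: "X \<in> obj C"
    { assume "X \<in> P"
      then show "sho C X \<in> P" by (intro closed[of "{X}"]) (use tt_ideal_shift[OF _ *] in auto) }
    { assume "sho C X \<in> P"
      then show "X \<in> P" by (intro closed[of "{sho C X}"]) (use tt_ideal_shift[OF _ *] in auto) }
  next
    fix X Y Z f g h assume *: "distinguished C X Y Z f g h"
    { assume "X \<in> P" "Y \<in> P"
      then show "Z \<in> P"
        by (intro closed[of "{X, Y}"]) (use tt_ideal_triangle(1)[OF _ *] in auto) }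
    { assume "Y \<in> P" "Z \<in> P"
      then show "X \<in> P"
        by (intro closed[of "{Y, Z}"]) (use tt_ideal_triangle(2)[OF _ *] in auto) }
    { assume "X \<in> P" "Z \<in> P"
      then show "Y \<in> P"
        by (intro closed[of "{X, Z}"]) (use tt_ideal_triangle(3)[OF _ *] in auto) }
  next
    fix X Y assume "X \<in> P" "Y \<in> obj C"
    then show "teno C X Y \<in> P" "teno C Y X \<in> P"
      by (auto intro!: closed[of "{X}"] intro: tt_ideal_tensor)
  qed
qed

section \<open>Ideals and isomorphisms, quotients by an object\<close>

context tt_category
begin

lemma tt_ideal_obj: "tt_ideal C (obj C)"
  by (rule tt_idealI)
    (auto simp: zero_object_def is_direct_sum_def biproduct_def distinguished_def triangle_def
      map_obj ten_obj)

lemma tt_ideal_iso: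
  assumes "tt_ideal C I" "f \<in> iso_hom C X Y"
  shows "X \<in> I \<longleftrightarrow> Y \<in> I"
proof -
  obtain Z g where "zero_object C Z" "g \<in> iso_hom C Y X"
    using ex_zero_object iso_hom_sym[OF assms(2)] by blast
  then show ?thesis
    using tt_ideal_summand[OF assms(1)] iso_is_direct_sum assms(2) by blast
qed

lemma tt_ideal_tensor_commute:
  "tt_ideal C I \<Longrightarrow> X \<in> obj C \<Longrightarrow> Y \<in> obj C \<Longrightarrow> X \<odot> Y \<in> I \<longleftrightarrow> Y \<odot> X \<in> I"
  using tt_ideal_iso brd_iso by blast

lemma tt_ideal_tensor_assoc:
  "tt_ideal C I \<Longrightarrow> X \<in> obj C \<Longrightarrow> Y \<in> obj C \<Longrightarrow> Z \<in> obj C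
    \<Longrightarrow> (X \<odot> Y) \<odot> Z \<in> I \<longleftrightarrow> X \<odot> (Y \<odot> Z) \<in> I"
  using tt_ideal_iso asc_iso by blast

lemma tt_ideal_unit_iff:
  assumes "tt_ideal C I"
  shows "tunit C \<in> I \<longleftrightarrow> I = obj C"
proof
  assume "tunit C \<in> I"
  then have "X \<in> I" if "X \<in> obj C" for X
    using tt_ideal_iso[OF assms lun_iso[OF that]] tt_ideal_tensor[OF assms] that by blast
  then show "I = obj C" using tt_ideal_subset[OF assms] by blast
qed (simp add: unit_obj)

text \<open>This is the preimage of \<open>I\<close> under the exact functor
  \<open>- \<odot> X\<close>, hence thick; associativity and the braiding give closure under
  tensoring. It permits arguments about generated ideals by minimality, without describing how their
  objects are built.\<close>

lemma tt_ideal_quotient: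
  assumes I: "tt_ideal C I" and X: "X \<in> obj C"
  shows "tt_ideal C {Y \<in> obj C. Y \<odot> X \<in> I}"
proof -
  have ex: "exact_endofunctor C (\<lambda>Y. Y \<odot> X) (\<lambda>f. f \<star> idn C X)" using ten_exact_left[OF X] .
  then interpret F: additive_endofunctor C "\<lambda>Y. Y \<odot> X" "\<lambda>f. f \<star> idn C X"
    by (simp add: exact_endofunctor_def)
  obtain \<theta> where \<theta>: "\<And>Y. Y \<in> obj C \<Longrightarrow> \<theta> Y \<in> iso_hom C (sho C Y \<odot> X) (sho C (Y \<odot> X))"
    and tri: "\<And>U V W f g h. distinguished C U V W f g h \<Longrightarrow>
      distinguished C (U \<odot> X) (V \<odot> X) (W \<odot> X) (f \<star> idn C X) (g \<star> idn C X) (\<theta> U \<cdot> (h \<star> idn C X))"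
    using ex by (auto simp: exact_endofunctor_def)
  have shift: "sho C Y \<odot> X \<in> I \<longleftrightarrow> Y \<odot> X \<in> I" if "Y \<in> obj C" for Y
    using tt_ideal_iso[OF I \<theta>[OF that]] tt_ideal_shift[OF I] ten_obj[OF that X] by blast
  note o = tt_ideal_obj
  show ?thesis
  \<comment> \<open>The case numbers follow the premises of \<open>tt_idealI\<close>. For shifts and
    triangles, \<open>\<theta>\<close> moves the shift past \<open>- \<odot> X\<close>.\<close>
  proof (rule tt_idealI, goal_cases)
    case 1 show ?case by blast
  next
    case (2 Z) then show ?case
      using tt_ideal_zero[OF I] tt_ideal_tensor(1)[OF I] X by (auto simp: zero_object_def)
  next
    case (3 U V B) then show ?case
      using tt_ideal_direct_sum[OF I F.map_is_direct_sum[OF 3(1)]] tt_ideal_direct_sum[OF o 3(1)]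
      by auto
  next
    case (4 U V B) then show ?case
      using tt_ideal_summand[OF I F.map_is_direct_sum[OF 4(1)]] tt_ideal_summand[OF o 4(1)]
      by auto
  next
    case (5 U) then show ?case using shift tt_ideal_shift[OF o] by blast
  next
    case (6 U) then show ?case using shift by blast
  next
    case (7 U V W) then show ?case
      using tt_ideal_triangle(1)[OF I tri[OF 7(1)]] tt_ideal_triangle(1)[OF o 7(1)] by blast
  next
    case (8 U V W) then show ?case
      using tt_ideal_triangle(2)[OF I tri[OF 8(1)]] tt_ideal_triangle(2)[OF o 8(1)] by blast
  next
    case (9 U V W) then show ?case
      using tt_ideal_triangle(3)[OF I tri[OF 9(1)]] tt_ideal_triangle(3)[OF o 9(1)] by blast
  next
    case (10 U V)
    then have "V \<odot> (U \<odot> X) \<in> I" using tt_ideal_tensor(2)[OF I] by blast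
    then have "(V \<odot> U) \<odot> X \<in> I" using tt_ideal_tensor_assoc[OF I] 10 X by blast
    \<comment> \<open>The braiding is applied inside the left factor, so it has to be transported
      along the functor \<open>- \<odot> X\<close>.\<close>
    moreover have "brd C V U \<star> idn C X \<in> iso_hom C ((V \<odot> U) \<odot> X) ((U \<odot> V) \<odot> X)"
      using F.map_iso[OF brd_iso] 10 by blast
    ultimately show ?case using tt_ideal_iso[OF I] 10 ten_obj by blast
  next
    case (11 U V)
    then have "V \<odot> (U \<odot> X) \<in> I" using tt_ideal_tensor(2)[OF I] by blast
    then show ?case using tt_ideal_tensor_assoc[OF I] 11 X ten_obj by blast
  qed
qed

section \<open>Tensor powers\<close>

lemma tensor_power_obj: "X \<in> obj C \<Longrightarrow> tensor_power C X n \<in> obj C"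
  by (induction n rule: induct_nat_012) (auto intro: ten_obj unit_obj)

text \<open>Passing to the ideal \<open>{Y. Y \<odot> X \<in> I}\<close> in the induction peels off one factor.\<close>

lemma tt_ideal_tensor_power_add:
  assumes X: "X \<in> obj C" and "1 \<le> m" and "tt_ideal C I"
  shows "tensor_power C X m \<odot> tensor_power C X (Suc n) \<in> I \<longleftrightarrow> tensor_power C X (m + Suc n) \<in> I"
  using assms(3)
proof (induction n arbitrary: I)
  case 0
  \<comment> \<open>For \<open>m \<ge> 1\<close> the recursion of \<open>tensor_power\<close> gives
    the claim literally; at \<open>m = 0\<close> the left side would be
    \<open>tunit C \<odot> X\<close> instead of \<open>X\<close>.\<close>
  obtain k where "m = Suc k" using \<open>1 \<le> m\<close> by (cases m) auto
  then show ?case by simp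
next
  case (Suc n)
  let ?J = "{Y \<in> obj C. Y \<odot> X \<in> I}"
  let ?p = "tensor_power C X"
  have "?p m \<odot> ?p (Suc (Suc n)) \<in> I \<longleftrightarrow> (?p m \<odot> ?p (Suc n)) \<odot> X \<in> I"
    using tt_ideal_tensor_assoc[OF Suc.prems] tensor_power_obj[OF X] X by simp
  also have "\<dots> \<longleftrightarrow> ?p m \<odot> ?p (Suc n) \<in> ?J"
    using tensor_power_obj[OF X] ten_obj by blast
  also have "\<dots> \<longleftrightarrow> ?p (m + Suc n) \<in> ?J"
    using Suc.IH[OF tt_ideal_quotient[OF Suc.prems X]] .
  also have "\<dots> \<longleftrightarrow> ?p (m + Suc (Suc n)) \<in> I"
    using tensor_power_obj[OF X] by simp
  finally show ?case .
qed

section \<open>Generated ideals\<close>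

lemma tt_ideal_generated:
  assumes "S \<subseteq> obj C"
  shows "tt_ideal C (generated_ideal C S)"
  unfolding generated_ideal_def hull_def
  by (rule tt_ideal_Inter) (use assms tt_ideal_obj in auto)

lemma subset_generated_ideal: "S \<subseteq> generated_ideal C S"
  unfolding generated_ideal_def by (rule hull_subset)

lemma generated_ideal_least: "tt_ideal C I \<Longrightarrow> generated_ideal C S \<subseteq> I \<longleftrightarrow> S \<subseteq> I"
  unfolding generated_ideal_def by (rule subset_hull)

text \<open>One variable is extended at a time. For fixed \<open>b\<close> in \<open>B\<close>, the
  objects whose product with \<open>b\<close> lies in \<open>P\<close> form an ideal containing
  \<open>A\<close>, hence everything \<open>A\<close> generates. Then \<open>s\<close> is fixed and
  the same is done for \<open>B\<close>, after swapping the factors.\<close>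

lemma tt_ideal_tensor_generated:
  assumes P: "tt_ideal C P" and A: "A \<subseteq> obj C" and B: "B \<subseteq> obj C"
    and AB: "\<And>a b. a \<in> A \<Longrightarrow> b \<in> B \<Longrightarrow> a \<odot> b \<in> P"
    and s: "s \<in> generated_ideal C A" and t: "t \<in> generated_ideal C B"
  shows "s \<odot> t \<in> P"
proof -
  have so: "s \<in> obj C" and to: "t \<in> obj C"
    using s t tt_ideal_subset tt_ideal_generated A B by blast+
  have sb: "s \<odot> b \<in> P" if "b \<in> B" for b
  proof -
    have "A \<subseteq> {Y \<in> obj C. Y \<odot> b \<in> P}" using A AB that by blast
    then have "generated_ideal C A \<subseteq> {Y \<in> obj C. Y \<odot> b \<in> P}"
      using generated_ideal_least tt_ideal_quotient[OF P] that B by blast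
    then show ?thesis using s by blast
  qed
  have "B \<subseteq> {Y \<in> obj C. Y \<odot> s \<in> P}"
    using sb B so tt_ideal_tensor_commute[OF P] by blast
  then have "generated_ideal C B \<subseteq> {Y \<in> obj C. Y \<odot> s \<in> P}"
    using generated_ideal_least tt_ideal_quotient[OF P so] by blast
  then show ?thesis using t to so tt_ideal_tensor_commute[OF P] by blast
qed

section \<open>Prime ideals and radicals\<close>

lemma prime_idealD:
  assumes "prime_ideal C P"
  shows "tt_ideal C P" "P \<noteq> obj C" "tunit C \<notin> P"
    and "X \<in> obj C \<Longrightarrow> Y \<in> obj C \<Longrightarrow> X \<odot> Y \<in> P \<Longrightarrow> X \<in> P \<or> Y \<in> P"
  using assms tt_ideal_unit_iff by (auto simp: prime_ideal_def)

lemma prime_ideal_tensor_power: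
  assumes P: "prime_ideal C P" and X: "X \<in> obj C" and "1 \<le> n" "tensor_power C X n \<in> P"
  shows "X \<in> P"
  using assms(3,4)
proof (induction n rule: nat_induct_at_least)
  case base then show ?case by simp
next
  case (Suc n)
  obtain k where "n = Suc k" using Suc.hyps by (cases n) auto
  then show ?case
    using prime_idealD(4)[OF P tensor_power_obj[OF X] X] Suc by auto
qed

lemma subset_radical: "I \<subseteq> obj C \<Longrightarrow> I \<subseteq> radical C I"
  by (auto simp: radical_def intro!: exI[of _ 1])

lemma radical_subset_prime:
  assumes "prime_ideal C P" "I \<subseteq> P"
  shows "radical C I \<subseteq> P"
  using prime_ideal_tensor_power[OF assms(1)] assms(2) by (auto simp: radical_def)

lemma prime_imp_radical_ideal: "prime_ideal C P \<Longrightarrow> radical_ideal C P"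
  using radical_subset_prime[of P P] subset_radical[of P] tt_ideal_subset[OF prime_idealD(1)]
    prime_idealD(1)
  by (auto simp: radical_ideal_def)

text \<open>Zorn's lemma gives an ideal maximal among those containing \<open>I\<close> and no
  tensor power of \<open>X\<close>. It is prime: if \<open>a\<close> and \<open>b\<close> were
  outside it, adjoining either one would capture a power of \<open>X\<close>, and
  \<open>a \<odot> b\<close> in \<open>P\<close> would put the product of these two powers into
  \<open>P\<close>.\<close>

lemma ex_prime_ideal_avoiding:
  assumes I: "tt_ideal C I" and X: "X \<in> obj C" "X \<notin> radical C I"
  shows "\<exists>P. prime_ideal C P \<and> I \<subseteq> P \<and> X \<notin> P"
proof -
  let ?S = "{tensor_power C X n | n. 1 \<le> n}"
  let ?F = "{J. tt_ideal C J \<and> I \<subseteq> J \<and> J \<inter> ?S = {}}"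
  have "I \<in> ?F" using I X by (auto simp: radical_def)
  have "\<exists>P\<in>?F. \<forall>J\<in>?F. P \<subseteq> J \<longrightarrow> J = P"
  proof (rule subset_Zorn_nonempty)
    show "?F \<noteq> {}" using \<open>I \<in> ?F\<close> by blast
  next
    fix \<C> assume \<C>: "\<C> \<noteq> {}" "subset.chain ?F \<C>"
    have "tt_ideal C (\<Union>\<C>)"
    \<comment> \<open>A finite part of the union of a chain already lies in one member of the
      chain.\<close>
    proof (rule tt_ideal_finitary)
      fix A B assume A: "finite A" "A \<subseteq> \<Union>\<C>" and B: "B \<inter> \<Union>\<C> = {}"
      obtain J where "J \<in> \<C>" "A \<subseteq> J"
        using finite_subset_Union_chain[OF A \<C>] by blast
      then show "\<exists>Q. tt_ideal C Q \<and> A \<subseteq> Q \<and> B \<inter> Q = {}"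
        using B \<C>(2) by (intro exI[of _ J]) (auto simp: subset.chain_def)
    qed
    then show "\<Union>\<C> \<in> ?F" using \<C> by (fastforce simp: subset.chain_def)
  qed
  then obtain P where P: "tt_ideal C P" "I \<subseteq> P" "P \<inter> ?S = {}"
    and max: "\<And>J. J \<in> ?F \<Longrightarrow> P \<subseteq> J \<Longrightarrow> J = P" by auto
  have "tensor_power C X 1 \<in> ?S" by blast
  then have "X \<notin> P" using P(3) by auto
  have enlarge: "\<exists>n\<ge>1. tensor_power C X n \<in> generated_ideal C (insert a P)"
    if a: "a \<in> obj C" "a \<notin> P" for a
  proof (rule ccontr)
    let ?J = "generated_ideal C (insert a P)"
    assume "\<not> ?thesis"
    moreover have "tt_ideal C ?J"
      using tt_ideal_generated a tt_ideal_subset[OF P(1)] by simp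
    moreover have "insert a P \<subseteq> ?J" by (rule subset_generated_ideal)
    ultimately show False using max[of ?J] P(2) a(2) by blast
  qed
  have "prime_ideal C P"
    unfolding prime_ideal_def
  proof (intro conjI ballI impI)
    show "tt_ideal C P" "P \<noteq> obj C" using P X \<open>X \<notin> P\<close> by auto
    fix a b assume ab: "a \<in> obj C" "b \<in> obj C" "a \<odot> b \<in> P"
    show "a \<in> P \<or> b \<in> P"
    proof (rule ccontr)
      assume "\<not> (a \<in> P \<or> b \<in> P)"
      then obtain m n where m: "1 \<le> m" "tensor_power C X m \<in> generated_ideal C (insert a P)"
        and n: "1 \<le> n" "tensor_power C X n \<in> generated_ideal C (insert b P)"
        using enlarge ab by meson
      \<comment> \<open>A product of a generator from \<open>insert a P\<close> with one from
        \<open>insert b P\<close> either has a factor in \<open>P\<close> or is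
        \<open>a \<odot> b\<close>.\<close>
      have "tensor_power C X m \<odot> tensor_power C X n \<in> P"
        by (rule tt_ideal_tensor_generated[OF P(1) _ _ _ m(2) n(2)])
          (use ab tt_ideal_subset[OF P(1)] tt_ideal_tensor[OF P(1)] in auto)
      moreover obtain k where "n = Suc k" using n(1) by (cases n) auto
      ultimately have "tensor_power C X (m + n) \<in> P"
        using tt_ideal_tensor_power_add[OF X(1) m(1) P(1), of k] by simp
      then show False using P(3) m(1) by fastforce
    qed
  qed
  then show ?thesis using P(2) \<open>X \<notin> P\<close> by blast
qed

text \<open>Primes absorb roots, and conversely an object outside the radical is avoided by some
  prime. Hence a radical is determined by which primes contain the ideal.\<close>

lemma radical_eq_Inter_primes:
  assumes "tt_ideal C I"
  shows "radical C I = {X \<in> obj C. \<forall>P\<in>Spc C. I \<subseteq> P \<longrightarrow> X \<in> P}"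
proof
  show "radical C I \<subseteq> {X \<in> obj C. \<forall>P\<in>Spc C. I \<subseteq> P \<longrightarrow> X \<in> P}"
  proof
    fix X assume X: "X \<in> radical C I"
    then have "X \<in> P" if "P \<in> Spc C" "I \<subseteq> P" for P
      using radical_subset_prime[of P I] that by (auto simp: Spc_def)
    then show "X \<in> {X \<in> obj C. \<forall>P\<in>Spc C. I \<subseteq> P \<longrightarrow> X \<in> P}"
      using X by (simp add: radical_def)
  qed
  show "{X \<in> obj C. \<forall>P\<in>Spc C. I \<subseteq> P \<longrightarrow> X \<in> P} \<subseteq> radical C I"
  proof
    fix X assume "X \<in> {X \<in> obj C. \<forall>P\<in>Spc C. I \<subseteq> P \<longrightarrow> X \<in> P}"
    then show "X \<in> radical C I"
      using ex_prime_ideal_avoiding[OF assms, of X] by (auto simp: Spc_def)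
  qed
qed

lemma radical_ideal_finitely_generated:
  assumes fin: "finite (Spc C)" and I: "radical_ideal C I"
  shows "finitely_generated C I"
proof -
  have ideal: "tt_ideal C I" and rad: "radical C I = I" using I by (auto simp: radical_ideal_def)
  \<comment> \<open>A witness in \<open>I\<close> separating it from \<open>P\<close>; the value is
    arbitrary when \<open>I \<subseteq> P\<close>, but \<open>F\<close> collects only genuine
    witnesses.\<close>
  define x where "x P = (SOME X. X \<in> I \<and> X \<notin> P)" for P
  have x: "x P \<in> I \<and> x P \<notin> P" if "\<not> I \<subseteq> P" for P
    unfolding x_def by (rule someI_ex) (use that in blast)
  define F where "F = x ` {P \<in> Spc C. \<not> I \<subseteq> P}"
  have F: "F \<subseteq> I" "finite F" using x fin by (auto simp: F_def)
  then have F_obj: "F \<subseteq> obj C" using tt_ideal_subset[OF ideal] by blast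
  have "F \<subseteq> P \<longleftrightarrow> I \<subseteq> P" if "P \<in> Spc C" for P
    using x that F(1) unfolding F_def by blast
  then have "generated_ideal C F \<subseteq> P \<longleftrightarrow> I \<subseteq> P" if "P \<in> Spc C" for P
    using that generated_ideal_least prime_idealD(1) by (auto simp: Spc_def)
  then have "radical C (generated_ideal C F) = radical C I"
    unfolding radical_eq_Inter_primes[OF ideal]
      radical_eq_Inter_primes[OF tt_ideal_generated[OF F_obj]] by auto
  then show ?thesis using F F_obj rad by (auto simp: finitely_generated_def)
qed

text \<open>Rephrases finite generation as a condition on finitely many memberships, the form that
  an accumulation point can be tested against. A prime containing \<open>F\<close> contains the
  ideal generated by \<open>F\<close> and, being prime, also its radical.\<close>

lemma finitely_generated_prime:
  assumes "prime_ideal C P" "finitely_generated C P"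
  shows "\<exists>F. finite F \<and> F \<subseteq> P \<and> (\<forall>Q. prime_ideal C Q \<longrightarrow> F \<subseteq> Q \<longrightarrow> P \<subseteq> Q)"
proof -
  obtain F where F: "finite F" "F \<subseteq> obj C" "P = radical C (generated_ideal C F)"
    using assms(2) by (auto simp: finitely_generated_def)
  have "F \<subseteq> P"
    using F subset_radical[OF tt_ideal_subset[OF tt_ideal_generated[OF F(2)]]]
      subset_generated_ideal by blast
  moreover have "P \<subseteq> Q" if "prime_ideal C Q" "F \<subseteq> Q" for Q
    using radical_subset_prime[OF that(1)] generated_ideal_least[OF prime_idealD(1)[OF that(1)]]
      that(2) F(3) by blast
  ultimately show ?thesis using F(1) by blast
qed

lemma prime_ideal_finitary:
  assumes approx: "\<And>A B. finite A \<Longrightarrow> finite B \<Longrightarrow> A \<subseteq> P \<Longrightarrow> B \<inter> P = {} \<Longrightarrow>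
      \<exists>Q. prime_ideal C Q \<and> A \<subseteq> Q \<and> B \<inter> Q = {}"
  shows "prime_ideal C P"
  unfolding prime_ideal_def
proof (intro conjI ballI impI)
  show "tt_ideal C P"
  proof (rule tt_ideal_finitary)
    fix A B :: "'o set"
    assume "finite A" "finite B" "A \<subseteq> P" "B \<inter> P = {}"
    from approx[OF this] show "\<exists>Q. tt_ideal C Q \<and> A \<subseteq> Q \<and> B \<inter> Q = {}"
      using prime_idealD(1) by blast
  qed
  \<comment> \<open>Properness is not visibly a finitary condition; for ideals it amounts to the
    single non-membership of the unit.\<close>
  have "tunit C \<notin> P" using approx[of "{tunit C}" "{}"] prime_idealD(3) by auto
  then show "P \<noteq> obj C" using unit_obj by auto
  fix X Y assume XY: "X \<in> obj C" "Y \<in> obj C" "X \<odot> Y \<in> P"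
  show "X \<in> P \<or> Y \<in> P"
  proof (rule ccontr)
    assume "\<not> (X \<in> P \<or> Y \<in> P)"
    then obtain Q where "prime_ideal C Q" "X \<odot> Y \<in> Q" "X \<notin> Q" "Y \<notin> Q"
      using approx[of "{X \<odot> Y}" "{X, Y}"] XY(3) by auto
    then show False using prime_idealD(4) XY by blast
  qed
qed

section \<open>The topology of the spectrum\<close>

lemma basic_open: "X \<in> obj C \<Longrightarrow> openin (spectrum C) {Q \<in> Spc C. X \<in> Q}"
  unfolding openin_spectrum[OF tt_category_axioms]
  by (intro exI[of _ "{X}"]) (auto simp: supp_def)

text \<open>Quasi-compactness leaves finitely many basic open sets. Lying outside \<open>U\<close>
  thus means excluding the finitely many objects of \<open>A\<close>.\<close>

lemma compact_open_finite_cover: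
  assumes "openin (spectrum C) U" "compactin (spectrum C) U"
  shows "\<exists>A. finite A \<and> U = {Q \<in> Spc C. A \<inter> Q \<noteq> {}}"
proof -
  obtain A where A: "A \<subseteq> obj C" "U = (\<Union>X\<in>A. Spc C - supp C X)"
    using assms(1) openin_spectrum[OF tt_category_axioms] by blast
  have "\<exists>\<F>. finite \<F> \<and> \<F> \<subseteq> (\<lambda>X. {Q \<in> Spc C. X \<in> Q}) ` A \<and> U \<subseteq> \<Union>\<F>"
    using assms(2) A basic_open by (intro compactinD) (auto simp: supp_def)
  then obtain \<F> where \<F>: "finite \<F>" "\<F> \<subseteq> (\<lambda>X. {Q \<in> Spc C. X \<in> Q}) ` A" "U \<subseteq> \<Union>\<F>"
    by auto
  obtain B where "finite B" "B \<subseteq> A" "U \<subseteq> (\<Union>X\<in>B. {Q \<in> Spc C. X \<in> Q})"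
    using finite_subset_image[OF \<F>(1,2)] \<F>(3) by auto
  then show ?thesis using A by (intro exI[of _ B]) (auto simp: supp_def)
qed

text \<open>The basic open sets consist of the primes containing a given object, so specialisation
  runs downwards: the closure of a point consists of the primes contained in it.\<close>

lemma openin_spectrum_mono:
  assumes "openin (spectrum C) U" "P \<in> U" "P \<subseteq> Q" "Q \<in> Spc C"
  shows "Q \<in> U"
  using assms unfolding openin_spectrum[OF tt_category_axioms] by (auto simp: supp_def)

text \<open>In a finite space every open set is quasi-compact. So the primes contained in
  \<open>P\<close> form a Thomason set, as do the primes not containing \<open>P\<close>, and these
  two sets cut out \<open>{P}\<close>.\<close>

lemma weakly_noetherian_finite:
  assumes fin: "finite (Spc C)"
  shows "weakly_noetherian (spectrum C)"
  unfolding weakly_noetherian_def weakly_visible_def topspace_spectrum[OF tt_category_axioms]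
proof
  fix P assume P: "P \<in> Spc C"
  have cpt: "compactin (spectrum C) U" if "U \<subseteq> Spc C" for U
    using that fin finite_subset topspace_spectrum[OF tt_category_axioms]
    by (intro finite_imp_compactin) auto
  have PC: "P \<subseteq> obj C" using P prime_idealD(1) tt_ideal_subset by (auto simp: Spc_def)
  have sub: "Q \<subseteq> obj C" if "Q \<in> Spc C" for Q
    using that prime_idealD(1) tt_ideal_subset by (auto simp: Spc_def)
  \<comment> \<open>\<open>V\<close> consists of the primes not contained in \<open>P\<close>, so
    its complement is the closure of \<open>P\<close>.\<close>
  define V where "V = (\<Union>X\<in>obj C - P. {Q \<in> Spc C. X \<in> Q})"
  have "openin (spectrum C) V" unfolding V_def using basic_open by (intro openin_Union) auto
  then have "thomason (spectrum C) (Spc C - V)"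
    unfolding thomason_def topspace_spectrum[OF tt_category_axioms]
    using cpt[of V] by (intro exI[of _ "{V}"]) (use V_def in auto)
  moreover have "thomason (spectrum C) (\<Union>X\<in>P. Spc C - {Q \<in> Spc C. X \<in> Q})"
    unfolding thomason_def topspace_spectrum[OF tt_category_axioms]
    by (rule exI[of _ "(\<lambda>X. {Q \<in> Spc C. X \<in> Q}) ` P"]) (use cpt basic_open PC in auto)
  moreover have "{P} = (Spc C - V) \<inter> (Spc C - (\<Union>X\<in>P. Spc C - {Q \<in> Spc C. X \<in> Q}))"
    using P sub unfolding V_def by blast
  ultimately show "\<exists>W1 W2. thomason (spectrum C) W1 \<and> thomason (spectrum C) W2 \<and>
      {P} = W1 \<inter> (Spc C - W2)" by blast
qed

text \<open>
  Every point containing \<open>P\<close> avoids \<open>W2\<close>, so \<open>{P}\<close> is already cut out by a closed set with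
  quasi-compact complement (from \<open>W1\<close>) together with the condition \<open>P \<subseteq> Q\<close>.
\<close>

lemma weakly_visible_point:
  assumes P: "P \<in> Spc C" and "weakly_visible (spectrum C) {P}"
  shows "\<exists>A. finite A \<and> A \<inter> P = {} \<and> (\<forall>Q\<in>Spc C. P \<subseteq> Q \<longrightarrow> A \<inter> Q = {} \<longrightarrow> Q = P)"
proof -
  obtain W1 W2 where W: "thomason (spectrum C) W1" "thomason (spectrum C) W2"
    and eq: "{P} = W1 \<inter> (Spc C - W2)"
    using assms(2) unfolding weakly_visible_def topspace_spectrum[OF tt_category_axioms] by blast
  obtain \<U>1 where \<U>1: "\<And>U. U \<in> \<U>1 \<Longrightarrow> openin (spectrum C) U \<and> compactin (spectrum C) U"
    and W1: "W1 = (\<Union>U\<in>\<U>1. Spc C - U)"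
    using W(1) unfolding thomason_def topspace_spectrum[OF tt_category_axioms] by auto
  obtain \<U>2 where \<U>2: "\<And>U. U \<in> \<U>2 \<Longrightarrow> openin (spectrum C) U"
    and W2: "W2 = (\<Union>U\<in>\<U>2. Spc C - U)"
    using W(2) unfolding thomason_def topspace_spectrum[OF tt_category_axioms] by auto
  \<comment> \<open>Since \<open>P\<close> lies in the union \<open>W1\<close>, one of the closed
    sets forming it contains \<open>P\<close>; this one alone is kept.\<close>
  obtain U where U: "U \<in> \<U>1" "P \<notin> U" using eq W1 by auto
  obtain A where A: "finite A" "U = {Q \<in> Spc C. A \<inter> Q \<noteq> {}}"
    using compact_open_finite_cover \<U>1[OF U(1)] by blast
  have "Q = P" if Q: "Q \<in> Spc C" "P \<subseteq> Q" "A \<inter> Q = {}" for Q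
  proof -
    have "P \<notin> W2" using eq by blast
    \<comment> \<open>Every \<open>V\<close> in \<open>\<U>2\<close> is an open set containing
      \<open>P\<close>, hence contains every prime above \<open>P\<close>.\<close>
    then have "Q \<in> V" if "V \<in> \<U>2" for V
      using openin_spectrum_mono[OF \<U>2[OF that] _ Q(2,1)] that P W2 by blast
    then have "Q \<notin> W2" using W2 by blast
    moreover have "Q \<in> W1" using W1 U(1) Q A by blast
    ultimately show ?thesis using eq Q(1) by blast
  qed
  then show ?thesis using A U(2) P by blast
qed

section \<open>Finiteness of the spectrum\<close>

lemma finite_Spc:
  assumes wn: "weakly_noetherian (spectrum C)"
    and fg: "\<And>P. prime_ideal C P \<Longrightarrow> finitely_generated C P"
  shows "finite (Spc C)"
proof (rule ccontr)
  assume "infinite (Spc C)"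
  then obtain P where lim: "\<And>A B. finite A \<Longrightarrow> finite B \<Longrightarrow> A \<subseteq> P \<Longrightarrow> B \<inter> P = {} \<Longrightarrow>
      \<exists>Q\<in>Spc C. Q \<noteq> P \<and> A \<subseteq> Q \<and> B \<inter> Q = {}"
    using infinite_family_accumulation by meson
  have P: "prime_ideal C P"
  proof (rule prime_ideal_finitary)
    fix A B :: "'o set"
    assume "finite A" "finite B" "A \<subseteq> P" "B \<inter> P = {}"
    from lim[OF this] show "\<exists>Q. prime_ideal C Q \<and> A \<subseteq> Q \<and> B \<inter> Q = {}"
      by (auto simp: Spc_def)
  qed
  obtain F where F: "finite F" "F \<subseteq> P" "\<And>Q. prime_ideal C Q \<Longrightarrow> F \<subseteq> Q \<Longrightarrow> P \<subseteq> Q"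
    using finitely_generated_prime[OF P fg[OF P]] by blast
  have "P \<in> Spc C" using P by (simp add: Spc_def)
  moreover from this have "weakly_visible (spectrum C) {P}"
    using wn topspace_spectrum[OF tt_category_axioms] by (simp add: weakly_noetherian_def)
  ultimately obtain A where A: "finite A" "A \<inter> P = {}"
    "\<forall>Q\<in>Spc C. P \<subseteq> Q \<longrightarrow> A \<inter> Q = {} \<longrightarrow> Q = P"
    using weakly_visible_point[of P] by auto
  \<comment> \<open>The finite sets \<open>F\<close> and \<open>A\<close> are prescribed together:
    \<open>F \<subseteq> Q\<close> forces \<open>P \<subseteq> Q\<close>, and then avoiding
    \<open>A\<close> forces \<open>Q = P\<close>, although the accumulation property supplies a
    different \<open>Q\<close>.\<close>
  obtain Q where "Q \<in> Spc C" "Q \<noteq> P" "F \<subseteq> Q" "A \<inter> Q = {}"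
    using lim[OF F(1) A(1) F(2) A(2)] by auto
  then show False using A(3) F(3) by (auto simp: Spc_def)
qed

end

theorem theorem7:
  fixes K :: "('o, 'm) tt_cat"
  assumes "tt_category K"
  shows "(weakly_noetherian (spectrum K) \<and> (\<forall>I. radical_ideal K I \<longrightarrow> finitely_generated K I)
            \<longleftrightarrow> weakly_noetherian (spectrum K) \<and> (\<forall>P. prime_ideal K P \<longrightarrow> finitely_generated K P)) \<and>
         (weakly_noetherian (spectrum K) \<and> (\<forall>P. prime_ideal K P \<longrightarrow> finitely_generated K P)
            \<longleftrightarrow> finite (Spc K))"
proof -
  interpret tt_category K by fact
  show ?thesis
    \<comment> \<open>The cycle is (a) to (b) because primes are radical, (b) to (c) by
      \<open>finite_Spc\<close>, and (c) to (a) by the two remaining facts.\<close>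
    using prime_imp_radical_ideal finite_Spc weakly_noetherian_finite
      radical_ideal_finitely_generated by blast
qed

end
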